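(* For a metric space $(X,d)$ the following statements are equivalent: (1) $(X,d)$ is Bourbaki-complete; (2) $C(X)=CC_{s_f\mu_d}(X)$.
   Context: For a metric space $(X,d)$, the metric uniformity $\mu_d$ is the family of covers of $X$ (uniform covers) refined by $\{B_d(x,\varepsilon):x\in X\}$ for some $\varepsilon>0$. For a cover $\mathcal U$ of $X$ and $A\subset X$: $St(A,\mathcal U)=\bigcup\{U\in\mathcal U: U\cap A\neq\emptyset\}$, $St^0(A,\mathcal U)=A$, $St^m(A,\mathcal U)=St(St^{m-1}(A,\mathcal U),\mathcal U)$ for $m\geq 1$. A filter $\mathcal F$ on $X$ is Bourbaki-Cauchy if for every $\mathcal U\in\mu_d$ there are $m\in\mathbb N$, $U\in\mathcal U$ and $F\in\mathcal F$ with $F\subset St^m(U,\mathcal U)$. $(X,d)$ is Bourbaki-complete if every Bourbaki-Cauchy filter has a cluster point. A cover is star-finite if each of its members meets at most finitely many of its members. $s_f\mu_d$ is the uniformity on $X$ having as a base all star-finite open covers belonging to $\mu_d$. $C(X)$ is the set of all real-valued continuous functions on $X$. For a uniformity $\nu$ on $X$, $CC_\nu(X)$ is the set of all real-valued Cauchy-continuous functions on $(X,\nu)$, i.e. functions $f:X\to\mathbb R$ mapping Cauchy filters of $(X,\nu)$ to (bases of) Cauchy filters of $\mathbb R$ with the Euclidean metric. *)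

theory Defs
  imports "HOL-Analysis.Elementary_Metric_Spaces"
begin

text \<open>
  Uniformities are given by uniform covers. A family of subsets of the space is a
  \<^typ>\<open>'a set set\<close>, and a uniformity is a set of such families. Filters are assumed proper
  wherever they occur, since the type \<^typ>\<open>'a filter\<close> also contains the improper filter
  \<^term>\<open>bot\<close>; membership of a set \<^term>\<open>A\<close> in a filter \<^term>\<open>F\<close> is
  \<^prop>\<open>eventually (\<lambda>x. x \<in> A) F\<close>.
\<close>

definition is_cover :: "'a set set \<Rightarrow> bool" where
  "is_cover \<U> \<longleftrightarrow> \<Union>\<U> = UNIV"

definition refines :: "'a set set \<Rightarrow> 'a set set \<Rightarrow> bool" where
  "refines \<V> \<U> \<longleftrightarrow> (\<forall>V\<in>\<V>. \<exists>U\<in>\<U>. V \<subseteq> U)"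

definition metric_covers :: "('a::metric_space) set set set" where
  "metric_covers = {\<U>. is_cover \<U> \<and> (\<exists>\<epsilon>>0. refines {ball x \<epsilon> | x. True} \<U>)}"

definition St :: "'a set \<Rightarrow> 'a set set \<Rightarrow> 'a set" where
  "St A \<U> = \<Union>{U\<in>\<U>. U \<inter> A \<noteq> {}}"

fun St_iter :: "nat \<Rightarrow> 'a set \<Rightarrow> 'a set set \<Rightarrow> 'a set" where
  "St_iter 0 A \<U> = A"
| "St_iter (Suc m) A \<U> = St (St_iter m A \<U>) \<U>"

definition Bourbaki_Cauchy :: "('a::metric_space) filter \<Rightarrow> bool" where
  "Bourbaki_Cauchy F \<longleftrightarrow>
     F \<noteq> bot \<and>
     (\<forall>\<U>\<in>metric_covers. \<exists>m. \<exists>U\<in>\<U>. \<exists>A. eventually (\<lambda>x. x \<in> A) F \<and> A \<subseteq> St_iter m U \<U>)"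

definition cluster_point :: "('a::topological_space) filter \<Rightarrow> 'a \<Rightarrow> bool" where
  "cluster_point F x \<longleftrightarrow> (\<forall>A. eventually (\<lambda>y. y \<in> A) F \<longrightarrow> x \<in> closure A)"

definition Bourbaki_complete :: "('a::metric_space) itself \<Rightarrow> bool" where
  "Bourbaki_complete _ \<longleftrightarrow> (\<forall>F :: 'a filter. Bourbaki_Cauchy F \<longrightarrow> (\<exists>x. cluster_point F x))"

definition star_finite :: "'a set set \<Rightarrow> bool" where
  "star_finite \<U> \<longleftrightarrow> (\<forall>U\<in>\<U>. finite {V\<in>\<U>. V \<inter> U \<noteq> {}})"

definition covers_with_base :: "'a set set set \<Rightarrow> 'a set set set" where
  "covers_with_base \<B> = {\<U>. is_cover \<U> \<and> (\<exists>\<V>\<in>\<B>. refines \<V> \<U>)}"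

definition sf_metric_covers :: "('a::metric_space) set set set" where
  "sf_metric_covers =
     covers_with_base {\<U>\<in>metric_covers. star_finite \<U> \<and> (\<forall>U\<in>\<U>. open U)}"

definition Cauchy_filter_wrt :: "'a set set set \<Rightarrow> 'a filter \<Rightarrow> bool" where
  "Cauchy_filter_wrt \<nu> F \<longleftrightarrow> F \<noteq> bot \<and> (\<forall>\<U>\<in>\<nu>. \<exists>U\<in>\<U>. eventually (\<lambda>x. x \<in> U) F)"

text \<open>
  The filter on the reals generated by the images of the members of \<^term>\<open>F\<close> is
  \<^term>\<open>filtermap f F\<close>; \<^term>\<open>cauchy_filter\<close> refers to the Euclidean uniformity of the reals.
\<close>

definition Cauchy_continuous_wrt :: "'a set set set \<Rightarrow> ('a \<Rightarrow> real) set" where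
  "Cauchy_continuous_wrt \<nu> =
     {f. \<forall>F. Cauchy_filter_wrt \<nu> F \<longrightarrow> cauchy_filter (filtermap f F)}"

end

theory Submission
  imports Defs
begin

text \<open>
  Suppose first that the space is Bourbaki-complete. A Cauchy filter of the star-finite uniformity
  is Bourbaki-Cauchy, because for every \<open>e > 0\<close> there is a star-finite open uniform cover whose
  members are annuli, each reached from a single ball by finitely many iterated stars in the cover
  by all \<open>e\<close>-balls (\<open>star_finite_chain_cover\<close>). Such a filter therefore has a cluster point, and it
  converges to that point (\<open>Cauchy_wrt_sf_cluster_imp_le_nhds\<close>), so every continuous function maps
  it to a convergent and hence Cauchy filter. Conversely, Cauchy-continuous functions are always
  continuous, since neighbourhood filters are Cauchy.

  Now suppose that continuous functions are Cauchy-continuous and that some Bourbaki-Cauchy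
  filter has no cluster point. Pass to a finer ultrafilter. It yields a Bourbaki-Cauchy sequence
  \<open>X\<close> without cluster point (\<open>Bourbaki_Cauchy_ultrafilter_imp_sequence\<close>). Since iterated stars
  of a star-finite cover are finite unions of members, every ultrafilter finer than the tail
  filter of \<open>X\<close> is Cauchy for the star-finite uniformity. But some continuous function tends to
  infinity along \<open>X\<close> (\<open>unbounded_continuous_along_sequence\<close>), so its image of such an
  ultrafilter is not Cauchy. The detour through a sequence matters: for an arbitrary ultrafilter
  without cluster point there may be no continuous function that tends to infinity along it, for
  example on a discrete space of measurable cardinality.
\<close>

section \<open>Ultrafilters\<close>

text \<open>Maximality among proper filters, expressed by the property that every set or its complement
  is a member.\<close>

definition ultrafilter :: "'a filter \<Rightarrow> bool" where
  "ultrafilter G \<longleftrightarrow> G \<noteq> bot \<and>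
     (\<forall>A. eventually (\<lambda>x. x \<in> A) G \<or> eventually (\<lambda>x. x \<notin> A) G)"

lemma ultrafilter_exists:
  assumes "F \<noteq> bot"
  shows "\<exists>G. ultrafilter G \<and> G \<le> F"
proof -
  let ?A = "{G. G \<noteq> bot \<and> G \<le> F}"
  \<comment> \<open>Zorn's lemma is applied to the reversed order, in which finer filters are larger.\<close>
  have po: "partial_order_on ?A (relation_of (\<lambda>a b. b \<le> a) ?A)"
    by (rule partial_order_on_relation_ofI) auto
  have "\<exists>u\<in>?A. \<forall>a\<in>C. u \<le> a" if C: "C \<in> Chains (relation_of (\<lambda>a b. b \<le> a) ?A)" for C
  proof (cases "C = {}")
    case True
    then show ?thesis using assms by auto
  next
    case False
    have sub: "C \<subseteq> ?A" and lin: "\<And>a b. a \<in> C \<Longrightarrow> b \<in> C \<Longrightarrow> b \<le> a \<or> a \<le> b"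
      using C by (auto simp: Chains_def relation_of_def)
    have "eventually P (Inf C) \<longleftrightarrow> (\<exists>b\<in>C. eventually P b)" for P
    proof (rule eventually_Inf_base[OF False])
      fix a b assume "a \<in> C" "b \<in> C"
      then show "\<exists>x\<in>C. x \<le> inf a b" using lin[of a b] by auto
    qed
    then have "Inf C \<noteq> bot"
      using sub by (auto simp: trivial_limit_def)
    moreover have "Inf C \<le> F"
      using False sub by (auto intro: Inf_lower2)
    ultimately show ?thesis by (auto intro: Inf_lower)
  qed
  from predicate_Zorn[OF po this] obtain G
    where G: "G \<noteq> bot" "G \<le> F"
      and max: "\<And>a. a \<noteq> bot \<Longrightarrow> a \<le> F \<Longrightarrow> a \<le> G \<Longrightarrow> a = G" by auto
  have "eventually (\<lambda>x. x \<in> A) G \<or> eventually (\<lambda>x. x \<notin> A) G" for A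
  proof (cases "inf G (principal A) = bot")
    case True
    then show ?thesis by (simp add: trivial_limit_def eventually_inf_principal)
  next
    case False
    then have "inf G (principal A) = G"
      by (rule max) (use G in \<open>auto intro: le_infI1\<close>)
    moreover have "eventually (\<lambda>x. x \<in> A) (inf G (principal A))"
      by (simp add: eventually_inf_principal)
    ultimately show ?thesis by simp
  qed
  then show ?thesis using G by (auto simp: ultrafilter_def)
qed

lemma ultrafilter_finite_Union:
  assumes "ultrafilter G" "finite \<T>" "eventually (\<lambda>x. x \<in> \<Union>\<T>) G"
  shows "\<exists>T\<in>\<T>. eventually (\<lambda>x. x \<in> T) G"
proof (rule ccontr)
  assume "\<not> ?thesis"
  then have "\<forall>T\<in>\<T>. eventually (\<lambda>x. x \<notin> T) G"
    using assms(1) by (auto simp: ultrafilter_def)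
  then have "eventually (\<lambda>x. \<forall>T\<in>\<T>. x \<notin> T) G"
    by (rule eventually_ball_finite[OF assms(2)])
  with assms(3) have "eventually (\<lambda>x. False) G"
    by eventually_elim auto
  then show False using assms(1) by (simp add: ultrafilter_def trivial_limit_def)
qed


section \<open>Filters and their cluster points\<close>

lemma cluster_point_mono: "cluster_point G x \<Longrightarrow> G \<le> F \<Longrightarrow> cluster_point F x"
  by (auto simp: cluster_point_def dest: filter_leD)

lemma cluster_point_metric:
  fixes x :: "'a::metric_space"
  shows "cluster_point F x \<longleftrightarrow> (\<forall>e>0. \<exists>\<^sub>F y in F. dist x y < e)"
proof
  assume c: "cluster_point F x"
  show "\<forall>e>0. \<exists>\<^sub>F y in F. dist x y < e"
  proof (intro allI impI)
    fix e :: real assume "e > 0"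
    show "\<exists>\<^sub>F y in F. dist x y < e"
    proof (rule ccontr)
      assume "\<not> (\<exists>\<^sub>F y in F. dist x y < e)"
      then have "eventually (\<lambda>y. y \<in> - ball x e) F"
        by (simp add: frequently_def)
      then have "x \<in> closure (- ball x e)" using c unfolding cluster_point_def by blast
      then show False using \<open>e > 0\<close> by (simp add: closure_complement)
    qed
  qed
next
  assume r: "\<forall>e>0. \<exists>\<^sub>F y in F. dist x y < e"
  show "cluster_point F x"
    unfolding cluster_point_def closure_approachable
  proof (intro allI impI)
    fix A and e :: real
    assume A: "eventually (\<lambda>y. y \<in> A) F" and "e > 0"
    then have "\<exists>\<^sub>F y in F. dist x y < e" using r by simp
    then have "\<exists>\<^sub>F y in F. y \<in> A \<and> dist x y < e"
      using A by (rule frequently_eventually_conj)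
    then show "\<exists>y\<in>A. dist y x < e"
      by (auto dest!: frequently_ex simp: dist_commute)
  qed
qed

lemma cluster_point_sequence:
  fixes X :: "nat \<Rightarrow> 'a::metric_space"
  shows "cluster_point (filtermap X sequentially) x \<longleftrightarrow>
    (\<forall>e>0. \<forall>N. \<exists>n\<ge>N. dist x (X n) < e)"
  by (simp add: cluster_point_metric frequently_def eventually_filtermap
      eventually_sequentially)

text \<open>A Cauchy filter has a member of diameter below \<open>1\<close>, which is bounded.\<close>

lemma not_cauchy_filter_if_unbounded:
  fixes H :: "real filter"
  assumes "H \<noteq> bot" and unb: "\<And>K. eventually (\<lambda>y. y \<ge> K) H"
  shows "\<not> cauchy_filter H"
proof
  assume "cauchy_filter H"
  then obtain P where P: "eventually P H" "\<And>x y. P x \<Longrightarrow> P y \<Longrightarrow> dist x y < 1"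
    unfolding cauchy_filter_metric by (meson zero_less_one)
  obtain x where "P x" using P(1) assms(1) eventually_happens by blast
  have "eventually (\<lambda>y. False) H"
    using P(1) unb[of "x + 1"]
  proof eventually_elim
    case (elim y)
    with P(2)[OF \<open>P x\<close>, of y] show False by (simp add: dist_real_def)
  qed
  then show False using assms(1) by (simp add: trivial_limit_def)
qed


section \<open>Stars and metric covers\<close>

text \<open>The cover by all open balls of a fixed radius; these covers form a base of the metric
  uniformity.\<close>

abbreviation ball_cover :: "real \<Rightarrow> ('a::metric_space) set set" where
  "ball_cover e \<equiv> {ball x e | x. True}"

lemma ball_cover_in_metric_covers: "e > 0 \<Longrightarrow> ball_cover e \<in> metric_covers"
  unfolding metric_covers_def is_cover_def refines_def
  by (auto intro: centre_in_ball[THEN iffD2])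

lemma St_iter_mono:
  assumes "refines \<V> \<U>" "A \<subseteq> B"
  shows "St_iter m A \<V> \<subseteq> St_iter m B \<U>"
proof (induction m)
  case 0
  then show ?case using assms(2) by simp
next
  case (Suc m)
  show ?case
  proof
    fix x assume "x \<in> St_iter (Suc m) A \<V>"
    then obtain V where V: "V \<in> \<V>" "V \<inter> St_iter m A \<V> \<noteq> {}" "x \<in> V"
      by (auto simp: St_def)
    then obtain U where "U \<in> \<U>" "V \<subseteq> U" using assms(1) unfolding refines_def by blast
    moreover from this have "U \<inter> St_iter m B \<U> \<noteq> {}" using V(2) Suc by blast
    ultimately show "x \<in> St_iter (Suc m) B \<U>" using V(3) by (auto simp: St_def)
  qed
qed

text \<open>For a filter to be Bourbaki-Cauchy it is enough to test the covers by all balls of a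
  fixed radius.\<close>

lemma Bourbaki_CauchyI_balls:
  fixes F :: "'a::metric_space filter"
  assumes "F \<noteq> bot"
    and balls: "\<And>e. e > 0 \<Longrightarrow> \<exists>m c. eventually (\<lambda>x. x \<in> St_iter m (ball c e) (ball_cover e)) F"
  shows "Bourbaki_Cauchy F"
  unfolding Bourbaki_Cauchy_def
proof (intro conjI ballI)
  show "F \<noteq> bot" by fact
  fix \<U> :: "'a set set" assume "\<U> \<in> metric_covers"
  then obtain e where e: "e > 0" "refines (ball_cover e) \<U>"
    by (auto simp: metric_covers_def)
  obtain m c where ev: "eventually (\<lambda>x. x \<in> St_iter m (ball c e) (ball_cover e)) F"
    using balls[OF e(1)] by auto
  obtain U where U: "U \<in> \<U>" "ball c e \<subseteq> U"
    using e(2) by (auto simp: refines_def)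
  then have "St_iter m (ball c e) (ball_cover e) \<subseteq> St_iter m U \<U>"
    using St_iter_mono[OF e(2)] by blast
  then show "\<exists>m. \<exists>U\<in>\<U>. \<exists>A. eventually (\<lambda>x. x \<in> A) F \<and> A \<subseteq> St_iter m U \<U>"
    using ev U(1) by blast
qed

lemma Bourbaki_Cauchy_balls:
  fixes F :: "'a::metric_space filter"
  assumes "Bourbaki_Cauchy F" "e > 0"
  shows "\<exists>m c. eventually (\<lambda>x. x \<in> St_iter m (ball c e) (ball_cover e)) F"
proof -
  obtain m U A where "U \<in> ball_cover e" "eventually (\<lambda>x. x \<in> A) F"
      "A \<subseteq> St_iter m U (ball_cover e)"
    using assms ball_cover_in_metric_covers[OF assms(2)]
    unfolding Bourbaki_Cauchy_def by blast
  then have "U \<in> ball_cover e" "eventually (\<lambda>x. x \<in> St_iter m U (ball_cover e)) F"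
    by (auto elim!: eventually_mono)
  then show ?thesis by blast
qed

lemma Bourbaki_Cauchy_mono:
  assumes "Bourbaki_Cauchy F" "G \<le> F" "G \<noteq> bot"
  shows "Bourbaki_Cauchy G"
  using assms unfolding Bourbaki_Cauchy_def by (meson filter_leD)

text \<open>Iterated stars of a member of a star-finite cover stay finite unions of members; this is
  where star-finiteness turns Bourbaki-Cauchy ultrafilters into Cauchy ones.\<close>

lemma St_iter_finite_Union:
  assumes "star_finite \<V>" "U \<in> \<V>"
  shows "\<exists>\<T>\<subseteq>\<V>. finite \<T> \<and> St_iter m U \<V> = \<Union>\<T>"
proof (induction m)
  case 0
  then show ?case using assms(2) by (intro exI[of _ "{U}"]) auto
next
  case (Suc m)
  then obtain \<T> where T: "\<T> \<subseteq> \<V>" "finite \<T>" "St_iter m U \<V> = \<Union>\<T>" by auto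
  let ?S = "\<Union>T\<in>\<T>. {V\<in>\<V>. V \<inter> T \<noteq> {}}"
  have "finite ?S" using T assms(1) by (auto simp: star_finite_def)
  moreover have "St_iter (Suc m) U \<V> = \<Union>?S"
    by (auto simp: T(3) St_def)
  ultimately show ?case by (intro exI[of _ ?S]) auto
qed

text \<open>The Cauchy property need only be tested on the base of star-finite open covers.\<close>

lemma Cauchy_wrt_sf_iff:
  "Cauchy_filter_wrt sf_metric_covers F \<longleftrightarrow> F \<noteq> bot \<and>
     (\<forall>\<V>\<in>metric_covers. star_finite \<V> \<longrightarrow> (\<forall>V\<in>\<V>. open V) \<longrightarrow>
        (\<exists>V\<in>\<V>. eventually (\<lambda>x. x \<in> V) F))"
  (is "?L \<longleftrightarrow> _ \<and> ?R")
proof (intro iffI conjI)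
  assume L: ?L
  then show "F \<noteq> bot" by (simp add: Cauchy_filter_wrt_def)
  show ?R
  proof (intro ballI impI)
    fix \<V> :: "'a set set" assume "\<V> \<in> metric_covers" "star_finite \<V>" "\<forall>V\<in>\<V>. open V"
    then have "\<V> \<in> sf_metric_covers"
      unfolding sf_metric_covers_def covers_with_base_def
      by (auto simp: metric_covers_def refines_def intro!: exI[of _ \<V>])
    then show "\<exists>V\<in>\<V>. eventually (\<lambda>x. x \<in> V) F"
      using L by (simp add: Cauchy_filter_wrt_def)
  qed
next
  assume R: "F \<noteq> bot \<and> ?R"
  show ?L
    unfolding Cauchy_filter_wrt_def
  proof (intro conjI ballI)
    show "F \<noteq> bot" using R by simp
    fix \<U> :: "'a set set" assume "\<U> \<in> sf_metric_covers"
    then obtain \<V> where V: "\<V> \<in> metric_covers" "star_finite \<V>" "\<forall>V\<in>\<V>. open V" "refines \<V> \<U>"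
      by (auto simp: sf_metric_covers_def covers_with_base_def)
    then obtain V where "V \<in> \<V>" "eventually (\<lambda>x. x \<in> V) F" using R by blast
    moreover from this obtain U where "U \<in> \<U>" "V \<subseteq> U" using V(4) by (auto simp: refines_def)
    ultimately show "\<exists>U\<in>\<U>. eventually (\<lambda>x. x \<in> U) F"
      by (auto elim!: eventually_mono)
  qed
qed

lemma nhds_Cauchy_wrt_sf: "Cauchy_filter_wrt sf_metric_covers (nhds x)"
  unfolding Cauchy_wrt_sf_iff
proof (intro conjI ballI impI)
  fix \<V> :: "'a set set" assume V: "\<V> \<in> metric_covers" "\<forall>V\<in>\<V>. open V"
  then have "x \<in> \<Union>\<V>" by (simp add: metric_covers_def is_cover_def)
  then obtain V where "V \<in> \<V>" "x \<in> V" by blast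
  with V(2) show "\<exists>V\<in>\<V>. eventually (\<lambda>x. x \<in> V) (nhds x)"
    by (auto intro: eventually_nhds_in_open)
qed simp

lemma ultrafilter_Bourbaki_Cauchy_imp_Cauchy_wrt_sf:
  assumes "ultrafilter G" "Bourbaki_Cauchy G"
  shows "Cauchy_filter_wrt sf_metric_covers G"
  unfolding Cauchy_wrt_sf_iff
proof (intro conjI ballI impI)
  show "G \<noteq> bot" using assms(1) by (simp add: ultrafilter_def)
  fix \<V> :: "'a set set" assume "\<V> \<in> metric_covers" and sf: "star_finite \<V>"
  then obtain m U A where U: "U \<in> \<V>" "eventually (\<lambda>x. x \<in> A) G" "A \<subseteq> St_iter m U \<V>"
    using assms(2) unfolding Bourbaki_Cauchy_def by blast
  obtain \<T> where T: "\<T> \<subseteq> \<V>" "finite \<T>" "St_iter m U \<V> = \<Union>\<T>"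
    using St_iter_finite_Union[OF sf U(1), of m] by auto
  have "eventually (\<lambda>x. x \<in> \<Union>\<T>) G"
    using U(2) by (rule eventually_mono) (use U(3) T(3) in auto)
  from ultrafilter_finite_Union[OF assms(1) T(2) this] T(1)
  show "\<exists>V\<in>\<V>. eventually (\<lambda>x. x \<in> V) G" by blast
qed


section \<open>Star-finite covers by annuli of chains\<close>

lemma St_ball_cover_step:
  assumes "e > 0" "y \<in> St_iter n (ball p e) (ball_cover e)" "dist y z < e"
  shows "z \<in> St_iter (Suc n) (ball p e) (ball_cover e)"
proof -
  have "ball y e \<in> ball_cover e" "z \<in> ball y e" "y \<in> ball y e" using assms by auto
  then show ?thesis using assms(2) unfolding St_iter.simps St_def by blast
qed

text \<open>Choose a base point in every component of the relation of being joined by a chain of steps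
  shorter than \<open>e\<close>, and let the level of a point count the iterated stars around its base point
  that are needed to reach it. Points closer than \<open>e\<close> share their base point and their levels
  differ by at most one; hence the \<open>e\<close>-neighbourhoods of the level sets meet only
  when the levels differ by at most two.\<close>

lemma star_finite_chain_cover:
  assumes e: "e > 0"
  shows "\<exists>\<W>::'a::metric_space set set. \<W> \<in> metric_covers \<and> star_finite \<W> \<and> (\<forall>W\<in>\<W>. open W) \<and>
    (\<forall>W\<in>\<W>. \<exists>m c. W \<subseteq> St_iter m (ball c e) (ball_cover e))"
proof -
  define E :: "'a rel" where "E = {(x, y). dist x y < e}"
  define S where "S p n = St_iter n (ball p e) (ball_cover e)" for p :: 'a and n
  define r where "r y = (SOME p. (p, y) \<in> E\<^sup>*)" for y
  define L where "L y = (LEAST n. y \<in> S (r y) n)" for y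
  have "sym E" by (auto simp: E_def sym_def dist_commute)
  then have symE: "(y, x) \<in> E\<^sup>*" if "(x, y) \<in> E\<^sup>*" for x y
    using that by (meson sym_rtrancl symE)
  have reach: "\<exists>n. y \<in> S p n" if "(p, y) \<in> E\<^sup>*" for p y
    using that
  proof (induction rule: rtrancl_induct)
    case base
    have "p \<in> S p 0" using e by (simp add: S_def)
    then show ?case ..
  next
    case (step y z)
    then obtain n where "y \<in> S p n" by auto
    then have "z \<in> S p (Suc n)"
      using St_ball_cover_step[OF e, of y n p z] step.hyps(2) by (auto simp: S_def E_def)
    then show ?case ..
  qed
  have r: "(r y, y) \<in> E\<^sup>*" for y unfolding r_def by (rule someI[of _ y]) simp
  have L: "y \<in> S (r y) (L y)" for y
    unfolding L_def using reach[OF r] by (rule LeastI_ex)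
  have r_eq: "r y = r z" if "dist y z < e" for y z
  proof -
    have yz: "(y, z) \<in> E\<^sup>*" using that by (auto simp: E_def)
    then have "(p, y) \<in> E\<^sup>* \<longleftrightarrow> (p, z) \<in> E\<^sup>*" for p
      using symE by (meson rtrancl_trans)
    then show ?thesis by (simp add: r_def)
  qed
  have L_le: "L z \<le> Suc (L y)" if "dist y z < e" for y z
  proof -
    have "z \<in> S (r z) (Suc (L y))"
      using St_ball_cover_step[OF e _ that] L[of y] r_eq[OF that] by (simp add: S_def)
    then show ?thesis unfolding L_def[of z] by (rule Least_le)
  qed
  \<comment> \<open>The annulus at level \<open>n\<close> around the base point \<open>p\<close>: the \<open>e\<close>-neighbourhood of a level set.
    It is empty for a \<open>p\<close> that is not a base point.\<close>
  define W where "W p n = (\<Union>y\<in>{y. r y = p \<and> L y = n}. ball y e)" for p n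
  have W_props: "r z = p" "L z \<le> Suc n" "n \<le> Suc (L z)" if z: "z \<in> W p n" for z p n
  proof -
    obtain y where y: "r y = p" "L y = n" "dist y z < e" using z by (auto simp: W_def)
    then show "r z = p" "L z \<le> Suc n" "n \<le> Suc (L z)"
      using r_eq[of y z] L_le[of y z] L_le[of z y] by (auto simp: dist_commute)
  qed
  let ?W = "{W p n | p n. True}"
  have "?W \<in> metric_covers"
    unfolding metric_covers_def is_cover_def refines_def
  proof (intro CollectI conjI exI[of _ e] ballI)
    have "y \<in> W (r y) (L y)" for y using e by (auto simp: W_def)
    then show "\<Union>?W = UNIV" by blast
    fix V :: "'a set" assume "V \<in> ball_cover e"
    then obtain y where "V = ball y e" by auto
    then have "V \<subseteq> W (r y) (L y)" by (auto simp: W_def)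
    then show "\<exists>U\<in>?W. V \<subseteq> U" by blast
  qed (rule e)
  moreover have "star_finite ?W"
    unfolding star_finite_def
  proof
    fix U assume "U \<in> ?W"
    then obtain p n where U: "U = W p n" by auto
    have "{V \<in> ?W. V \<inter> U \<noteq> {}} \<subseteq> W p ` {..n + 2}"
    proof
      fix V assume "V \<in> {V \<in> ?W. V \<inter> U \<noteq> {}}"
      then obtain q k z where "V = W q k" "z \<in> W q k" "z \<in> W p n" using U by auto
      moreover from this have "q = p" "k \<le> n + 2"
        using W_props[of z q k] W_props[of z p n] by auto
      ultimately show "V \<in> W p ` {..n + 2}" by auto
    qed
    then show "finite {V \<in> ?W. V \<inter> U \<noteq> {}}" by (rule finite_subset) simp
  qed
  moreover have "\<forall>V\<in>?W. open V" by (auto simp: W_def)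
  moreover have "\<forall>V\<in>?W. \<exists>m c. V \<subseteq> St_iter m (ball c e) (ball_cover e)"
  proof
    fix V assume "V \<in> ?W"
    then obtain p n where V: "V = W p n" by auto
    have "V \<subseteq> S p (Suc n)"
    proof
      fix z assume "z \<in> V"
      then obtain y where "r y = p" "L y = n" "dist y z < e" using V by (auto simp: W_def)
      then show "z \<in> S p (Suc n)"
        using St_ball_cover_step[OF e, of y n p z] L[of y] by (simp add: S_def)
    qed
    then show "\<exists>m c. V \<subseteq> St_iter m (ball c e) (ball_cover e)" unfolding S_def by blast
  qed
  ultimately show ?thesis by blast
qed

lemma Cauchy_wrt_sf_imp_Bourbaki_Cauchy:
  fixes F :: "'a::metric_space filter"
  assumes "Cauchy_filter_wrt sf_metric_covers F"
  shows "Bourbaki_Cauchy F"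
proof (rule Bourbaki_CauchyI_balls)
  show "F \<noteq> bot" using assms by (simp add: Cauchy_filter_wrt_def)
  fix e :: real assume "e > 0"
  from star_finite_chain_cover[OF this] obtain \<W> :: "'a set set"
    where W: "\<W> \<in> metric_covers" "star_finite \<W>" "\<forall>W\<in>\<W>. open W"
      "\<forall>W\<in>\<W>. \<exists>m c. W \<subseteq> St_iter m (ball c e) (ball_cover e)" by blast
  then obtain V where "V \<in> \<W>" "eventually (\<lambda>x. x \<in> V) F"
    using assms unfolding Cauchy_wrt_sf_iff by blast
  moreover from this(1) W(4) obtain m c where "V \<subseteq> St_iter m (ball c e) (ball_cover e)"
    by blast
  ultimately have "eventually (\<lambda>x. x \<in> St_iter m (ball c e) (ball_cover e)) F"
    by (auto elim!: eventually_mono)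
  then show "\<exists>m c. eventually (\<lambda>x. x \<in> St_iter m (ball c e) (ball_cover e)) F" by blast
qed

text \<open>The star-finite uniformity induces the topology of the metric, already through the
  two-element covers by a ball and the complement of a smaller closed ball; so its Cauchy filters
  converge to their cluster points.\<close>

lemma Cauchy_wrt_sf_cluster_imp_le_nhds:
  fixes F :: "'a::metric_space filter"
  assumes F: "Cauchy_filter_wrt sf_metric_covers F" and x: "cluster_point F x"
  shows "F \<le> nhds x"
proof -
  have "eventually (\<lambda>y. dist y x < e) F" if e: "e > 0" for e
  proof -
    let ?V = "{ball x e, - cball x (e/2)}"
    have "?V \<in> metric_covers"
      unfolding metric_covers_def is_cover_def refines_def
    proof (intro CollectI conjI exI[of _ "e/4"] ballI)
      show "\<Union>?V = UNIV" using e by auto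
      show "e / 4 > 0" using e by simp
      fix V :: "'a set" assume "V \<in> ball_cover (e/4)"
      then obtain y where V: "V = ball y (e/4)" by auto
      show "\<exists>U\<in>?V. V \<subseteq> U"
      proof (cases "dist x y < 3 * e / 4")
        case True
        have "V \<subseteq> ball x e"
        proof
          fix z assume "z \<in> V"
          then show "z \<in> ball x e" using V True dist_triangle[of x z y] by simp
        qed
        then show ?thesis by blast
      next
        case False
        have "V \<subseteq> - cball x (e/2)"
        proof
          fix z assume "z \<in> V"
          then show "z \<in> - cball x (e/2)"
            using V False dist_triangle[of x y z] by (simp add: dist_commute)
        qed
        then show ?thesis by blast
      qed
    qed
    moreover have "star_finite ?V" by (simp add: star_finite_def)
    moreover have "\<forall>V\<in>?V. open V" by (simp add: open_Compl)
    ultimately consider "eventually (\<lambda>y. y \<in> ball x e) F"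
      | "eventually (\<lambda>y. y \<in> - cball x (e/2)) F"
      using F unfolding Cauchy_wrt_sf_iff by blast
    then show ?thesis
    proof cases
      case 1
      then show ?thesis by (simp add: dist_commute)
    next
      case 2
      then have "eventually (\<lambda>y. \<not> dist x y < e/2) F" by (rule eventually_mono) simp
      moreover have "\<exists>\<^sub>F y in F. dist x y < e/2"
        using x e unfolding cluster_point_metric by (meson half_gt_zero)
      ultimately show ?thesis by (simp add: frequently_def)
    qed
  qed
  then have "filterlim (\<lambda>y. y) (nhds x) F" by (intro tendstoI)
  then show ?thesis by (simp add: filterlim_def)
qed

lemma Cauchy_continuous_wrt_sf_imp_continuous:
  assumes "f \<in> Cauchy_continuous_wrt sf_metric_covers"
  shows "continuous_on UNIV f"
proof -
  have "isCont f x" for x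
  proof -
    have c: "cauchy_filter (filtermap f (nhds x))"
      using assms nhds_Cauchy_wrt_sf by (auto simp: Cauchy_continuous_wrt_def)
    have "eventually (\<lambda>y. dist (f y) (f x) < e) (nhds x)" if "e > 0" for e
    proof -
      obtain P where P: "eventually (\<lambda>y. P (f y)) (nhds x)" "\<And>u v. P u \<Longrightarrow> P v \<Longrightarrow> dist u v < e"
        using c \<open>e > 0\<close> unfolding cauchy_filter_metric eventually_filtermap by blast
      have "P (f x)" using P(1) by (rule eventually_nhds_x_imp_x)
      from P(1) show ?thesis by (rule eventually_mono) (rule P(2)[OF _ \<open>P (f x)\<close>])
    qed
    then have "filterlim f (nhds (f x)) (nhds x)" by (intro tendstoI)
    then show ?thesis by (simp add: isCont_def tendsto_nhds_iff)
  qed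
  then show ?thesis by (simp add: continuous_at_imp_continuous_on)
qed


section \<open>Sequences without cluster points\<close>

text \<open>The infimum of the distances to the terms \<open>X n\<close>, each increased by \<open>1/(n+1)\<close>, is a
  \<open>1\<close>-Lipschitz function that vanishes exactly at the cluster points of \<open>X\<close>.\<close>

lemma unbounded_continuous_along_sequence:
  fixes X :: "nat \<Rightarrow> 'a::metric_space"
  assumes "\<nexists>x. cluster_point (filtermap X sequentially) x"
  shows "\<exists>f::'a \<Rightarrow> real. continuous_on UNIV f \<and> (\<forall>n. f (X n) \<ge> real n + 1)"
proof -
  define h where "h x = (INF n. dist x (X n) + 1 / (real n + 1))" for x
  have bdd: "bdd_below (range (\<lambda>n. dist x (X n) + 1 / (real n + 1)))" for x
    by (rule bdd_belowI[of _ 0]) auto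
  have h_le: "h x \<le> dist x (X n) + 1 / (real n + 1)" for x n
    unfolding h_def by (rule cINF_lower[OF bdd]) simp
  have h_ge: "c \<le> h x" if "\<And>n. c \<le> dist x (X n) + 1 / (real n + 1)" for c x
    unfolding h_def by (rule cINF_greatest) (use that in auto)
  have h_pos: "h x > 0" for x
  proof -
    obtain e N where e: "e > 0" "\<And>n. n \<ge> N \<Longrightarrow> dist x (X n) \<ge> e"
      using assms unfolding cluster_point_sequence by (meson not_less)
    \<comment> \<open>Late terms are at distance at least \<open>e\<close>, and early ones carry a summand of at least
      \<open>1/(N+1)\<close>.\<close>
    have "min e (1 / (real N + 1)) \<le> h x"
    proof (rule h_ge)
      fix n
      show "min e (1 / (real N + 1)) \<le> dist x (X n) + 1 / (real n + 1)"
      proof (cases "n \<ge> N")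
        case True
        have "0 \<le> 1 / (real n + 1)" by simp
        then show ?thesis using e(2)[OF True] by linarith
      next
        case False
        then have "1 / (real N + 1) \<le> 1 / (real n + 1)" by (simp add: frac_le)
        moreover have "0 \<le> dist x (X n)" by simp
        ultimately show ?thesis by linarith
      qed
    qed
    moreover have "min e (1 / (real N + 1)) > 0" using e(1) by simp
    ultimately show ?thesis by linarith
  qed
  have h_lip: "h x \<le> h y + dist x y" for x y
  proof -
    have "h x - dist x y \<le> h y"
    proof (rule h_ge)
      fix n
      show "h x - dist x y \<le> dist y (X n) + 1 / (real n + 1)"
        using h_le[of x n] dist_triangle[of x "X n" y] by linarith
    qed
    then show ?thesis by linarith
  qed
  have "continuous_on UNIV h"
    unfolding continuous_on_iff
  proof (intro ballI allI impI)
    fix x and e :: real assume "e > 0"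
    moreover have "dist (h y) (h x) \<le> dist y x" for y
      using h_lip[of x y] h_lip[of y x] by (simp add: dist_real_def dist_commute)
    ultimately show "\<exists>d>0. \<forall>y\<in>UNIV. dist y x < d \<longrightarrow> dist (h y) (h x) < e"
      by (meson le_less_trans)
  qed
  then have "continuous_on UNIV (\<lambda>x. 1 / h x)"
    using h_pos by (intro continuous_on_divide continuous_on_const)
      (simp_all add: less_imp_neq[symmetric])
  moreover have "1 / h (X n) \<ge> real n + 1" for n
    using h_le[of "X n" n] h_pos[of "X n"] by (simp add: field_simps)
  ultimately show ?thesis by blast
qed

text \<open>The ultrafilter yields a sequence running through a decreasing
  sequence of its members that witness the Bourbaki-Cauchy property. If the ultrafilter contains
  balls of every radius, the sequence can be kept inside such shrinking balls and a cluster point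
  of the sequence would be one of the ultrafilter. Otherwise no member of the ultrafilter is
  covered by finitely many balls of some radius \<open>e\<close>, and the terms can be kept at distance at
  least \<open>e\<close> from each other.\<close>

lemma Bourbaki_Cauchy_ultrafilter_imp_sequence:
  fixes G :: "'a::metric_space filter"
  assumes ult: "ultrafilter G" and BC: "Bourbaki_Cauchy G"
    and nocl: "\<nexists>x. cluster_point G x"
  shows "\<exists>X::nat \<Rightarrow> 'a. Bourbaki_Cauchy (filtermap X sequentially) \<and>
    (\<nexists>x. cluster_point (filtermap X sequentially) x)"
proof -
  have Gbot: "G \<noteq> bot" using ult by (simp add: ultrafilter_def)
  define \<epsilon> where "\<epsilon> n = 1 / (real n + 1)" for n
  have eps_pos: "\<epsilon> n > 0" for n by (simp add: \<epsilon>_def)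
  have eps_small: "\<exists>N. \<forall>n\<ge>N. \<epsilon> n < e" if e: "e > 0" for e
  proof -
    obtain N where N: "1 / (real (Suc N)) < e" using nat_approx_posE[OF e] by blast
    have "\<epsilon> n < e" if "n \<ge> N" for n
    proof -
      have "\<epsilon> n \<le> 1 / real (Suc N)" using that by (simp add: \<epsilon>_def frac_le)
      then show ?thesis using N by linarith
    qed
    then show ?thesis by blast
  qed
  have "\<forall>n. \<exists>m c. eventually (\<lambda>x. x \<in> St_iter m (ball c (\<epsilon> n)) (ball_cover (\<epsilon> n))) G"
    using Bourbaki_Cauchy_balls[OF BC eps_pos] by blast
  then obtain m c where
    mc: "\<And>n. eventually (\<lambda>x. x \<in> St_iter (m n) (ball (c n) (\<epsilon> n)) (ball_cover (\<epsilon> n))) G"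
    by metis
  define D where "D n = (\<Inter>k\<le>n. St_iter (m k) (ball (c k) (\<epsilon> k)) (ball_cover (\<epsilon> k)))" for n
  have D_G: "eventually (\<lambda>x. x \<in> D n) G" for n
    unfolding D_def using mc by (simp add: eventually_ball_finite)
  have seq_BC: "Bourbaki_Cauchy (filtermap X sequentially)" if X: "\<And>n. X n \<in> D n" for X
  proof (rule Bourbaki_CauchyI_balls)
    show "filtermap X sequentially \<noteq> bot" by (simp add: filtermap_bot_iff)
    fix e :: real assume "e > 0"
    then obtain k where k: "\<epsilon> k < e" using eps_small by blast
    have "refines (ball_cover (\<epsilon> k)) (ball_cover e :: 'a set set)"
      using k unfolding refines_def by (force dest: less_trans)
    then have "St_iter (m k) (ball (c k) (\<epsilon> k)) (ball_cover (\<epsilon> k))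
        \<subseteq> St_iter (m k) (ball (c k) e) (ball_cover e)"
      by (rule St_iter_mono) (use k in auto)
    then have "\<forall>n\<ge>k. X n \<in> St_iter (m k) (ball (c k) e) (ball_cover e)"
      using X by (auto simp: D_def)
    then have "eventually (\<lambda>x. x \<in> St_iter (m k) (ball (c k) e) (ball_cover e))
        (filtermap X sequentially)"
      unfolding eventually_filtermap eventually_sequentially by blast
    then show "\<exists>m c. eventually (\<lambda>x. x \<in> St_iter m (ball c e) (ball_cover e))
        (filtermap X sequentially)" by blast
  qed
  show ?thesis
  proof (cases "\<forall>e>0. \<exists>b. eventually (\<lambda>x. x \<in> ball b e) G")
    case True
    then have "\<forall>n. \<exists>b. eventually (\<lambda>x. x \<in> ball b (\<epsilon> n)) G" using eps_pos by blast
    then obtain b where b: "\<And>n. eventually (\<lambda>x. x \<in> ball (b n) (\<epsilon> n)) G" by metis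
    have "\<exists>x. x \<in> D n \<and> x \<in> ball (b n) (\<epsilon> n)" for n
      using eventually_happens'[OF Gbot eventually_conj[OF D_G b]] by blast
    then obtain X where X: "\<And>n. X n \<in> D n" "\<And>n. X n \<in> ball (b n) (\<epsilon> n)" by metis
    \<comment> \<open>Near a cluster point of \<open>X\<close> there is a term \<open>X n\<close> with \<open>n\<close> large, and the small ball
      around \<open>b n\<close> that contains it belongs to \<open>G\<close>.\<close>
    have "cluster_point G x" if x: "cluster_point (filtermap X sequentially) x" for x
      unfolding cluster_point_metric
    proof (intro allI impI)
      fix e :: real assume e: "e > 0"
      then obtain N where N: "\<And>n. n \<ge> N \<Longrightarrow> \<epsilon> n < e / 3" using eps_small[of "e/3"] by auto
      obtain n where n: "n \<ge> N" "dist x (X n) < e / 3"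
        using x e unfolding cluster_point_sequence by (meson divide_pos_pos zero_less_numeral)
      have "eventually (\<lambda>y. dist x y < e) G"
        using b[of n]
      proof eventually_elim
        case (elim y)
        have "dist x y \<le> dist x (X n) + dist (X n) (b n) + dist (b n) y"
          using dist_triangle[of x y "X n"] dist_triangle[of "X n" y "b n"] by linarith
        then show ?case using elim n(2) N[OF n(1)] X(2)[of n] by (simp add: dist_commute)
      qed
      then show "\<exists>\<^sub>F y in G. dist x y < e"
        using Gbot by (rule eventually_frequently[rotated])
    qed
    then show ?thesis using seq_BC[OF X(1)] nocl by (intro exI[of _ X]) auto
  next
    case False
    then obtain e where e: "e > 0" and nb: "\<And>b. \<not> eventually (\<lambda>x. x \<in> ball b e) G" by blast
    have out: "eventually (\<lambda>x. x \<notin> ball b e) G" for b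
      using ult nb[of b] unfolding ultrafilter_def by blast
    have "\<exists>X. \<forall>n. X n \<in> D n \<and> (\<forall>k<n. X n \<notin> ball (X k) e)"
    proof (rule dependent_wellorder_choice)
      fix n and X :: "nat \<Rightarrow> 'a"
      have "eventually (\<lambda>x. \<forall>k\<in>{..<n}. x \<notin> ball (X k) e) G"
        by (rule eventually_ball_finite) (use out in auto)
      from eventually_happens'[OF Gbot eventually_conj[OF D_G[of n] this]]
      show "\<exists>x. x \<in> D n \<and> (\<forall>k<n. x \<notin> ball (X k) e)" by auto
    qed auto
    then obtain X where X: "\<And>n. X n \<in> D n" "\<And>n k. k < n \<Longrightarrow> dist (X k) (X n) \<ge> e"
      by (auto simp: not_less)
    have "\<not> cluster_point (filtermap X sequentially) x" for x
    proof
      assume x: "cluster_point (filtermap X sequentially) x"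
      then have near: "\<exists>n\<ge>N. dist x (X n) < e/2" for N
        using e unfolding cluster_point_sequence by (meson half_gt_zero)
      obtain k where k: "dist x (X k) < e/2" using near by blast
      obtain n where n: "n \<ge> Suc k" "dist x (X n) < e/2" using near by blast
      have "dist (X k) (X n) < e"
        using k n(2) dist_triangle3[of "X k" "X n" x] by linarith
      with X(2)[of k n] n(1) show False by simp
    qed
    then show ?thesis using seq_BC[OF X(1)] by (intro exI[of _ X]) auto
  qed
qed


section \<open>Bourbaki-completeness and Cauchy-continuity\<close>

theorem theorem3p2p1:
  "Bourbaki_complete TYPE('a::metric_space) \<longleftrightarrow>
     {f :: 'a \<Rightarrow> real. continuous_on UNIV f} = Cauchy_continuous_wrt sf_metric_covers"
proof
  assume complete: "Bourbaki_complete TYPE('a)"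
  show "{f :: 'a \<Rightarrow> real. continuous_on UNIV f} = Cauchy_continuous_wrt sf_metric_covers"
  proof (intro equalityI subsetI)
    fix f :: "'a \<Rightarrow> real" assume "f \<in> {f. continuous_on UNIV f}"
    then have cont: "isCont f x" for x by (simp add: continuous_on_eq_continuous_at)
    show "f \<in> Cauchy_continuous_wrt sf_metric_covers"
      unfolding Cauchy_continuous_wrt_def
    proof (intro CollectI allI impI)
      fix F :: "'a filter" assume F: "Cauchy_filter_wrt sf_metric_covers F"
      then obtain x where "cluster_point F x"
        using complete Cauchy_wrt_sf_imp_Bourbaki_Cauchy unfolding Bourbaki_complete_def by blast
      then have "F \<le> nhds x" by (rule Cauchy_wrt_sf_cluster_imp_le_nhds[OF F])
      moreover have "filterlim f (nhds (f x)) (nhds x)"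
        using cont[of x] by (simp add: isCont_def tendsto_at_iff_tendsto_nhds)
      ultimately have "filtermap f F \<le> nhds (f x)"
        by (meson filterlim_def filtermap_mono order_trans)
      then show "cauchy_filter (filtermap f F)" by (rule nhds_imp_cauchy_filter)
    qed
  qed (use Cauchy_continuous_wrt_sf_imp_continuous in auto)
next
  assume eq: "{f :: 'a \<Rightarrow> real. continuous_on UNIV f} = Cauchy_continuous_wrt sf_metric_covers"
  show "Bourbaki_complete TYPE('a)"
    unfolding Bourbaki_complete_def
  proof (intro allI impI, rule ccontr)
    fix F :: "'a filter"
    assume F: "Bourbaki_Cauchy F" and nocl: "\<nexists>x. cluster_point F x"
    obtain G where G: "ultrafilter G" "G \<le> F"
      using F ultrafilter_exists unfolding Bourbaki_Cauchy_def by blast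
    have "Bourbaki_Cauchy G"
      using G(1) by (intro Bourbaki_Cauchy_mono[OF F G(2)]) (simp add: ultrafilter_def)
    moreover have "\<nexists>x. cluster_point G x" using nocl cluster_point_mono[OF _ G(2)] by blast
    ultimately obtain X :: "nat \<Rightarrow> 'a"
      where X: "Bourbaki_Cauchy (filtermap X sequentially)"
        "\<nexists>x. cluster_point (filtermap X sequentially) x"
      using Bourbaki_Cauchy_ultrafilter_imp_sequence[OF G(1)] by blast
    obtain f :: "'a \<Rightarrow> real" where f: "continuous_on UNIV f" "\<And>n. f (X n) \<ge> real n + 1"
      using unbounded_continuous_along_sequence[OF X(2)] by blast
    obtain H where H: "ultrafilter H" "H \<le> filtermap X sequentially"
      using X(1) ultrafilter_exists unfolding Bourbaki_Cauchy_def by blast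
    have Hbot: "H \<noteq> bot" using H(1) by (simp add: ultrafilter_def)
    have "Cauchy_filter_wrt sf_metric_covers H"
      by (rule ultrafilter_Bourbaki_Cauchy_imp_Cauchy_wrt_sf[OF H(1)
            Bourbaki_Cauchy_mono[OF X(1) H(2) Hbot]])
    then have "cauchy_filter (filtermap f H)"
      using f(1) eq by (auto simp: Cauchy_continuous_wrt_def)
    moreover have "eventually (\<lambda>y. y \<ge> K) (filtermap f H)" for K
    proof -
      obtain N where N: "K \<le> real N" using real_arch_simple by blast
      have "K \<le> f (X n)" if "n \<ge> N" for n
        using f(2)[of n] N that by linarith
      then have "eventually (\<lambda>x. K \<le> f x) (filtermap X sequentially)"
        unfolding eventually_filtermap eventually_sequentially by blast
      from filter_leD[OF H(2) this] show ?thesis by (simp add: eventually_filtermap)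
    qed
    ultimately show False
      using not_cauchy_filter_if_unbounded[of "filtermap f H"] Hbot
      by (simp add: filtermap_bot_iff)
  qed
qed

end
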